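(* Let $(\mathbb{Q},\delta)$ be a proper metric space (of densities with respect to some measure on $\mathbb{R}^d$), and let $\delta_{\mathsf L}$ be the intrinsic metric induced by $\delta$. Suppose that $q_1,\dots,q_n\in\mathbb{Q}$ are such that $$\varepsilon_n:=\sup_{q\in\mathbb{Q}}\min_{i\in[n]}\delta(q,q_i)\to0\quad\text{as }n\to\infty.$$ Assume that $\delta_{\mathsf L}(q,q_0)=\delta(q,q_0)[1+\omega(q,q_0)]$ for all $q,q_0\in\mathbb{Q}$, where $\omega$ is continuous with $\omega(q,q)=0$ for all $q$. Fix $i$ and $j$ such that $\delta_{\mathsf L}(q_i,q_j)<\infty$. Then, with a choice of connectivity radius $r_n\to0$ slowly enough that $\varepsilon_n/r_n\to0$, the graph distance $d_{ij}$ is consistent for $\delta_{\mathsf L}(q_i,q_j)$, i.e. $d_{ij}\to\delta_{\mathsf L}(q_i,q_j)$ as $n\to\infty$.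
   Context: A metric space is proper if every closed ball in it is compact. The length of a path (continuous curve) $\gamma:[a,b]\to\mathbb{Q}$ is $$\mathsf L(\gamma)=\sup_{a=t_0<\dots<t_k=b}\ \sum_{i=1}^k\delta(\gamma(t_{i-1}),\gamma(t_i)),$$ and $\delta_{\mathsf L}(q,q')=\inf\{\mathsf L(\gamma):\gamma\text{ connects }q,q'\}$, where $\gamma$ connects $q,q'$ if $\gamma(a)=q$ and $\gamma(b)=q'$. The graph distance $d_{ij}$ (which depends on $n$) is the shortest-path distance between $q_i$ and $q_j$ in the graph with node set $\{q_1,\dots,q_n\}$ and edge set $\{(q_k,q_l):\delta(q_k,q_l)\le r_n\}$, the edge $(q_k,q_l)$ having weight $\delta(q_k,q_l)$. $[n]=\{1,\dots,n\}$. *)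

theory Defs
  imports "HOL-Probability.Probability" "Graph_Theory.Shortest_Path"
begin

text \<open>
  Densities are represented by functions rather than by almost-everywhere classes. A space of
  classes is covered by choosing one representative per class.
\<close>
definition prob_density :: "'x measure \<Rightarrow> ('x \<Rightarrow> real) \<Rightarrow> bool" where
  "prob_density \<nu> q \<longleftrightarrow>
     q \<in> borel_measurable \<nu> \<and> (AE x in \<nu>. 0 \<le> q x) \<and> (\<integral>\<^sup>+x. ennreal (q x) \<partial>\<nu>) = 1"

definition proper_metric_space :: "'a set \<Rightarrow> ('a \<Rightarrow> 'a \<Rightarrow> real) \<Rightarrow> bool" where
  "proper_metric_space M d \<longleftrightarrow> Metric_space M d \<and>
     (\<forall>x\<in>M. \<forall>r. compactin (Metric_space.mtopology M d) (Metric_space.mcball M d x r))"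

definition path_length :: "('a \<Rightarrow> 'a \<Rightarrow> real) \<Rightarrow> real \<Rightarrow> real \<Rightarrow> (real \<Rightarrow> 'a) \<Rightarrow> ereal" where
  "path_length d a b \<gamma> =
     Sup {ereal (\<Sum>i=1..k. d (\<gamma> (t (i - 1))) (\<gamma> (t i))) | (k::nat) t.
            t 0 = a \<and> t k = b \<and> (\<forall>i\<in>{1..k}. t (i - 1) < t i)}"

definition connecting_path ::
  "'a set \<Rightarrow> ('a \<Rightarrow> 'a \<Rightarrow> real) \<Rightarrow> real \<Rightarrow> real \<Rightarrow> (real \<Rightarrow> 'a) \<Rightarrow> 'a \<Rightarrow> 'a \<Rightarrow> bool" where
  "connecting_path M d a b \<gamma> x y \<longleftrightarrow>
     a \<le> b \<and> continuous_map (top_of_set {a..b}) (Metric_space.mtopology M d) \<gamma> \<and>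
     \<gamma> a = x \<and> \<gamma> b = y"

text \<open>The infimum of the empty set is \<open>\<infinity>\<close>, the value for points not joined by any path.\<close>
definition intrinsic_dist :: "'a set \<Rightarrow> ('a \<Rightarrow> 'a \<Rightarrow> real) \<Rightarrow> 'a \<Rightarrow> 'a \<Rightarrow> ereal" where
  "intrinsic_dist M d x y = Inf {path_length d a b \<gamma> | a b \<gamma>. connecting_path M d a b \<gamma> x y}"

text \<open>
  An undirected edge is a pair of opposite arcs: the arc set is symmetric whenever \<open>d\<close> is.
  The loops present for \<open>r \<ge> 0\<close> have weight 0 if \<open>d\<close> is a metric.
\<close>
definition neighbourhood_graph ::
  "('a \<Rightarrow> 'a \<Rightarrow> real) \<Rightarrow> 'a set \<Rightarrow> real \<Rightarrow> ('a, 'a \<times> 'a) pre_digraph" where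
  "neighbourhood_graph d V r =
     \<lparr>verts = V, arcs = {(x, y). x \<in> V \<and> y \<in> V \<and> d x y \<le> r}, tail = fst, head = snd\<rparr>"

lemma wf_digraph_neighbourhood_graph: "wf_digraph (neighbourhood_graph d V r)"
  by unfold_locales (auto simp: neighbourhood_graph_def)

text \<open>
  \<open>wf_digraph.\<mu>\<close> is the infimum of the costs of all walks, which is \<open>\<infinity>\<close> if there is none; in
  particular if \<open>x\<close> or \<open>y\<close> is not a node.
\<close>
definition graph_dist :: "('a \<Rightarrow> 'a \<Rightarrow> real) \<Rightarrow> 'a set \<Rightarrow> real \<Rightarrow> 'a \<Rightarrow> 'a \<Rightarrow> ereal" where
  "graph_dist d V r x y = wf_digraph.\<mu> (neighbourhood_graph d V r) (\<lambda>(u, v). d u v) x y"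

text \<open>
  Extended-real valued, since the supremum may be infinite for small \<open>n\<close>. The value at
  \<open>n = 0\<close>, where \<open>Min\<close> is applied to the empty set, is junk.
\<close>
definition covering_radius ::
  "'a set \<Rightarrow> ('a \<Rightarrow> 'a \<Rightarrow> real) \<Rightarrow> (nat \<Rightarrow> 'a) \<Rightarrow> nat \<Rightarrow> ereal" where
  "covering_radius M d q n = (SUP x\<in>M. ereal (MIN i\<in>{1..n}. d x (q i)))"

end

theory Submission
  imports Defs
begin

text \<open>
  The graph distance is compared with the intrinsic distance \<open>L\<close> of the two sample points from
  both sides. Finiteness of the covering radius makes the proper space a finite union of closed
  balls, hence compact, and this is what turns the pointwise hypothesis on \<open>\<omega>\<close> into a uniform one.

  Upper bound (\<open>graph_dist_le_of_path\<close>). Take a path of length at most \<open>l\<close>, where \<open>l\<close> is close to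
  \<open>L\<close>, and march along it in steps that cover distance exactly \<open>r / 2\<close> until the end is within
  \<open>r / 2\<close> (\<open>subdivide_path\<close>). Since the lengths of the steps add up to at most \<open>l\<close>, there are at
  most \<open>2 l / r + 1\<close> of them. Moving every way point to a nearest sample point, at distance at most
  \<open>e\<close>, lengthens a step by at most \<open>2 e\<close>: the steps become edges as soon as \<open>4 e \<le> r\<close>, and the
  total is at most \<open>l + 2 e (2 l / r + 1)\<close>, which tends to \<open>l\<close> because \<open>e / r\<close> and \<open>e\<close> tend to 0.

  Lower bound (\<open>le_graph_dist_if_edges_not_shortcuts\<close>). A Lebesgue number for a cover of the
  compact space shows that \<open>\<omega> < \<eta>\<close> for all pairs of points that are close enough
  (\<open>uniformly_small_near_diagonal\<close>). So once \<open>r\<close> is small, an edge of the graph has weight at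
  least \<open>1 / (1 + \<eta>)\<close> times the intrinsic distance of its ends. The triangle inequality for the
  intrinsic distance, which rests on the concatenation of paths, extends this from edges to walks,
  and the graph distance is at least \<open>L / (1 + \<eta>)\<close>.
\<close>

section \<open>Lengths of paths\<close>

text \<open>
  Indexing a step by its left end makes the case of \<open>k\<close> steps and the induction to \<open>Suc k\<close> match.
\<close>
lemma path_length_eq_Sup_steps:
  "path_length d a b \<gamma> =
     Sup {ereal (\<Sum>i<k. d (\<gamma> (t i)) (\<gamma> (t (Suc i)))) | (k::nat) t.
            t 0 = a \<and> t k = b \<and> (\<forall>i<k. t i < t (Suc i))}"
proof -
  have "(\<forall>i\<in>{1..k}. t (i - 1) < t i) \<longleftrightarrow> (\<forall>i<k. t i < t (Suc i))" for k and t :: "nat \<Rightarrow> real"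
    unfolding image_Suc_lessThan[symmetric] by auto
  moreover have "(\<Sum>i=1..k. d (\<gamma> (t (i - 1))) (\<gamma> (t i))) = (\<Sum>i<k. d (\<gamma> (t i)) (\<gamma> (t (Suc i))))"
    for k and t :: "nat \<Rightarrow> real"
    using sum.atLeast1_atMost_eq[of "\<lambda>i. d (\<gamma> (t (i - 1))) (\<gamma> (t i))" k] by simp
  ultimately show ?thesis
    unfolding path_length_def by simp
qed

lemma monotone_partition_within:
  fixes t :: "nat \<Rightarrow> real"
  assumes "\<And>i. i < k \<Longrightarrow> t i \<le> t (Suc i)" "i \<le> k"
  shows "t 0 \<le> t i \<and> t i \<le> t k"
proof -
  have "t m \<le> t n" if "m \<le> n" "n \<le> k" for m n
    using that(1) that(2) by (induction rule: dec_induct) (use assms(1) in \<open>auto intro: order_trans\<close>)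
  then show ?thesis using assms(2) by simp
qed

context Metric_space
begin

text \<open>
  Repeated partition points contribute the distance of a point to itself, so they can be dropped.
\<close>
lemma strict_partition_of_monotone_partition:
  fixes t :: "nat \<Rightarrow> real"
  assumes "\<And>i. i < k \<Longrightarrow> t i \<le> t (Suc i)" and "\<And>i. i \<le> k \<Longrightarrow> \<gamma> (t i) \<in> M"
  shows "\<exists>k' t'. t' 0 = t 0 \<and> t' k' = t k \<and> (\<forall>i<k'. t' i < t' (Suc i)) \<and>
           (\<Sum>i<k'. d (\<gamma> (t' i)) (\<gamma> (t' (Suc i)))) = (\<Sum>i<k. d (\<gamma> (t i)) (\<gamma> (t (Suc i))))"
  using assms
proof (induction k)
  case 0
  then show ?case by (intro exI[of _ 0] exI[of _ t]) auto
next
  case (Suc k)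
  then obtain k' t' where t': "t' 0 = t 0" "t' k' = t k" "\<forall>i<k'. t' i < t' (Suc i)"
    "(\<Sum>i<k'. d (\<gamma> (t' i)) (\<gamma> (t' (Suc i)))) = (\<Sum>i<k. d (\<gamma> (t i)) (\<gamma> (t (Suc i))))"
    by fastforce
  show ?case
  proof (cases "t k = t (Suc k)")
    case True
    then show ?thesis
      using t' Suc.prems(2)[of "Suc k"] by (intro exI[of _ k'] exI[of _ t']) simp
  next
    case False
    define u where "u = t'(Suc k' := t (Suc k))"
    have "(\<Sum>i<k'. d (\<gamma> (u i)) (\<gamma> (u (Suc i)))) = (\<Sum>i<k'. d (\<gamma> (t' i)) (\<gamma> (t' (Suc i))))"
      by (intro sum.cong) (auto simp: u_def)
    moreover have "t k < t (Suc k)"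
      using False Suc.prems(1)[of k] by simp
    ultimately show ?thesis
      using t' by (intro exI[of _ "Suc k'"] exI[of _ u]) (auto simp: u_def less_Suc_eq)
  qed
qed

text \<open>
  Weakly increasing partitions give lower bounds for the length as well. They arise when a
  partition is clamped to a subinterval or extended by an end point that it may already contain.
\<close>
lemma sum_le_path_length:
  fixes t :: "nat \<Rightarrow> real"
  assumes "t 0 = a" "t k = b" "\<And>i. i < k \<Longrightarrow> t i \<le> t (Suc i)"
    and "\<And>i. i \<le> k \<Longrightarrow> \<gamma> (t i) \<in> M"
  shows "ereal (\<Sum>i<k. d (\<gamma> (t i)) (\<gamma> (t (Suc i)))) \<le> path_length d a b \<gamma>"
proof -
  obtain k' t' where "t' 0 = t 0" "t' k' = t k" "\<forall>i<k'. t' i < t' (Suc i)"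
    "(\<Sum>i<k'. d (\<gamma> (t' i)) (\<gamma> (t' (Suc i)))) = (\<Sum>i<k. d (\<gamma> (t i)) (\<gamma> (t (Suc i))))"
    using strict_partition_of_monotone_partition[of k t \<gamma>] assms(3,4) by blast
  then show ?thesis
    unfolding path_length_eq_Sup_steps using assms(1,2)
    by (intro Sup_upper) (auto intro!: exI[of _ k'] exI[of _ t'])
qed

lemma connecting_path_in_space:
  assumes "connecting_path M d a b \<gamma> x y" "s \<in> {a..b}"
  shows "\<gamma> s \<in> M"
  using assms continuous_map_image_subset_topspace unfolding connecting_path_def by fastforce

lemma path_length_nonneg: 
  assumes "connecting_path M d a b \<gamma> x y"
  shows "0 \<le> path_length d a b \<gamma>"
proof -
  have "ereal (\<Sum>i<(1::nat). d (\<gamma> (if i = 0 then a else b)) (\<gamma> (if Suc i = 0 then a else b)))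
      \<le> path_length d a b \<gamma>"
    using assms
    by (intro sum_le_path_length[where t = "\<lambda>i. if i = 0 then a else b"])
       (auto intro!: connecting_path_in_space[OF assms] simp: connecting_path_def)
  moreover have "0 \<le> ereal (d (\<gamma> a) (\<gamma> b))" by simp
  ultimately show ?thesis using order_trans[of 0 "ereal (d (\<gamma> a) (\<gamma> b))"] by simp
qed

text \<open>
  The second path is shifted to start where the first one ends. Every partition of the joined
  interval clamps to a partition of each half, and by the triangle inequality the step across the
  junction is bounded by its two parts.
\<close>
lemma concatenate_paths:
  assumes g: "connecting_path M d a b \<gamma> x y" and h: "connecting_path M d a' b' \<gamma>' y z"
  shows "\<exists>a'' b'' \<gamma>''. connecting_path M d a'' b'' \<gamma>'' x z \<and>
           path_length d a'' b'' \<gamma>'' \<le> path_length d a b \<gamma> + path_length d a' b' \<gamma>'"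
proof -
  define e where "e = b + b' - a'"
  define \<eta> where "\<eta> = (\<lambda>s. if s \<le> b then \<gamma> s else \<gamma>' (s - b + a'))"
  have ab: "a \<le> b" "a' \<le> b'" "\<gamma> a = x" "\<gamma> b = y" "\<gamma>' a' = y" "\<gamma>' b' = z"
    and cg: "continuous_map (top_of_set {a..b}) mtopology \<gamma>"
    and ch: "continuous_map (top_of_set {a'..b'}) mtopology \<gamma>'"
    using g h by (auto simp: connecting_path_def)
  have sub: "subtopology (top_of_set {a..e}) {s \<in> topspace (top_of_set {a..e}). s \<le> b} = top_of_set {a..b}"
    "subtopology (top_of_set {a..e}) {s \<in> topspace (top_of_set {a..e}). b \<le> s} = top_of_set {b..e}"
    using ab by (auto simp: subtopology_subtopology e_def intro!: arg_cong[of _ _ top_of_set])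
  have shift: "continuous_map (top_of_set {b..e}) (top_of_set {a'..b'}) (\<lambda>s. s - b + a')"
    by (auto simp: e_def continuous_map_in_subtopology intro!: continuous_intros)
  have ch': "continuous_map (top_of_set {b..e}) mtopology (\<lambda>s. \<gamma>' (s - b + a'))"
    using continuous_map_compose[OF shift ch] by (simp add: o_def)
  have ceta: "continuous_map (top_of_set {a..e}) mtopology \<eta>"
    unfolding \<eta>_def
    by (rule continuous_map_cases_le) (use cg ch' ab in \<open>auto simp: sub[simplified]\<close>)
  have conn: "connecting_path M d a e \<eta> x z"
    using ab ceta by (auto simp: connecting_path_def \<eta>_def e_def)
  have "path_length d a e \<eta> \<le> path_length d a b \<gamma> + path_length d a' b' \<gamma>'"
    unfolding path_length_eq_Sup_steps[of d a e \<eta>]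
  proof (rule Sup_least)
    fix z
    assume "z \<in> {ereal (\<Sum>i<k. d (\<eta> (t i)) (\<eta> (t (Suc i)))) | (k::nat) t.
                  t 0 = a \<and> t k = e \<and> (\<forall>i<k. t i < t (Suc i))}"
    then obtain k t where z: "z = ereal (\<Sum>i<k. d (\<eta> (t i)) (\<eta> (t (Suc i))))"
      and t: "t 0 = a" "t k = e" "\<forall>i<k. t i < t (Suc i)"
      by blast
    \<comment> \<open>The partition is split at \<open>b\<close> by clamping it to either side; the clamped
      partitions are constant on the other side, so they are only weakly increasing.\<close>
    define u v where "u = (\<lambda>i. min (t i) b)" and "v = (\<lambda>i. max (t i) b - b + a')"
    have tin: "a \<le> t i \<and> t i \<le> e" if "i \<le> k" for i
      using monotone_partition_within[of k t i] t that by (simp add: less_imp_le)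
    have uM: "\<gamma> (u i) \<in> M" if "i \<le> k" for i
      using connecting_path_in_space[OF g, of "u i"] tin[OF that] ab by (auto simp: u_def)
    have vM: "\<gamma>' (v i) \<in> M" if "i \<le> k" for i
      using connecting_path_in_space[OF h, of "v i"] tin[OF that] ab by (auto simp: v_def e_def)
    have step: "d (\<eta> (t i)) (\<eta> (t (Suc i)))
        \<le> d (\<gamma> (u i)) (\<gamma> (u (Suc i))) + d (\<gamma>' (v i)) (\<gamma>' (v (Suc i)))" if "i < k" for i
    proof -
      have lt: "t i < t (Suc i)" using t that by blast
      consider "t (Suc i) \<le> b" | "t i \<le> b" "b < t (Suc i)" | "b < t i" by linarith
      then show ?thesis
      proof cases
        \<comment> \<open>Only the step across \<open>b\<close> touches both paths: it is broken at the junction \<open>y\<close>.\<close>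
        case 2
        then have "\<gamma> (u (Suc i)) = \<gamma>' (v i)" using ab by (simp add: u_def v_def)
        then show ?thesis
          using 2 triangle[OF uM[of i] uM[of "Suc i"] vM[of "Suc i"]] that
          by (simp add: \<eta>_def u_def v_def)
      qed (use lt in \<open>auto simp: \<eta>_def u_def v_def\<close>)
    qed
    have "ereal (\<Sum>i<k. d (\<eta> (t i)) (\<eta> (t (Suc i))))
        \<le> ereal (\<Sum>i<k. d (\<gamma> (u i)) (\<gamma> (u (Suc i)))) + ereal (\<Sum>i<k. d (\<gamma>' (v i)) (\<gamma>' (v (Suc i))))"
      using sum_mono[of "{..<k}", OF step] by (simp add: sum.distrib)
    also have "\<dots> \<le> path_length d a b \<gamma> + path_length d a' b' \<gamma>'"
    proof (rule add_mono)
      have "u i \<le> u (Suc i) \<and> v i \<le> v (Suc i)" if "i < k" for i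
        using t that by (auto simp: u_def v_def min_def max_def dest!: spec[of _ i])
      moreover have "u 0 = a" "u k = b" "v 0 = a'" "v k = b'"
        using t(1,2) ab by (auto simp: u_def v_def e_def)
      ultimately show "ereal (\<Sum>i<k. d (\<gamma> (u i)) (\<gamma> (u (Suc i)))) \<le> path_length d a b \<gamma>"
        "ereal (\<Sum>i<k. d (\<gamma>' (v i)) (\<gamma>' (v (Suc i)))) \<le> path_length d a' b' \<gamma>'"
        using uM vM by (auto intro!: sum_le_path_length)
    qed
    finally show "z \<le> path_length d a b \<gamma> + path_length d a' b' \<gamma>'"
      unfolding z .
  qed
  then show ?thesis using conn by blast
qed

section \<open>The intrinsic distance\<close>

text \<open>
  The constant path on a degenerate interval has length 0.
\<close>
lemma intrinsic_dist_refl_le: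
  assumes "x \<in> M"
  shows "intrinsic_dist M d x x \<le> 0"
proof -
  have c: "connecting_path M d 0 0 (\<lambda>_. x) x x"
    using assms by (simp add: connecting_path_def)
  have "path_length d 0 0 (\<lambda>_. x) \<le> 0"
    unfolding path_length_eq_Sup_steps using assms by (auto intro!: Sup_least)
  moreover have "intrinsic_dist M d x x \<le> path_length d 0 0 (\<lambda>_. x)"
    unfolding intrinsic_dist_def using c by (auto intro!: Inf_lower)
  ultimately show ?thesis by (rule order_trans[rotated])
qed

lemma intrinsic_dist_nonneg: "0 \<le> intrinsic_dist M d x y"
  unfolding intrinsic_dist_def by (rule Inf_greatest) (auto intro: path_length_nonneg)

text \<open>
  Near-optimal paths from \<open>x\<close> to \<open>y\<close> and from \<open>y\<close> to \<open>z\<close> are concatenated.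
\<close>
lemma intrinsic_dist_triangle:
  "intrinsic_dist M d x z \<le> intrinsic_dist M d x y + intrinsic_dist M d y z"
proof (rule dense_ge)
  fix c assume c: "intrinsic_dist M d x y + intrinsic_dist M d y z < c"
  show "intrinsic_dist M d x z \<le> c"
  proof (cases "intrinsic_dist M d x y = \<infinity> \<or> intrinsic_dist M d y z = \<infinity>")
    case True
    then show ?thesis using c by auto
  next
    case False
    then obtain p q where pq: "intrinsic_dist M d x y = ereal p" "intrinsic_dist M d y z = ereal q"
      using intrinsic_dist_nonneg[of x y] intrinsic_dist_nonneg[of y z]
      by (cases "intrinsic_dist M d x y"; cases "intrinsic_dist M d y z") auto
    then obtain w where w: "p + q < w" "ereal w < c"
      using c ereal_dense2[of "ereal (p+q)" c] by auto
    define h where "h = (w - p - q) / 2"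
    \<comment> \<open>Half of the slack \<open>w - (p + q)\<close> goes to each of the two paths.\<close>
    have "Inf {path_length d a b \<gamma> | a b \<gamma>. connecting_path M d a b \<gamma> x y} < ereal (p + h)"
      "Inf {path_length d a b \<gamma> | a b \<gamma>. connecting_path M d a b \<gamma> y z} < ereal (q + h)"
      using pq w unfolding intrinsic_dist_def by (simp_all add: h_def)
    then obtain a b \<gamma> a' b' \<gamma>' where g: "connecting_path M d a b \<gamma> x y" "path_length d a b \<gamma> < ereal (p + h)"
      and g': "connecting_path M d a' b' \<gamma>' y z" "path_length d a' b' \<gamma>' < ereal (q + h)"
      unfolding Inf_less_iff by blast
    obtain a2 b2 \<gamma>2 where g2: "connecting_path M d a2 b2 \<gamma>2 x z"
       "path_length d a2 b2 \<gamma>2 \<le> path_length d a b \<gamma> + path_length d a' b' \<gamma>'"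
      using concatenate_paths[OF g(1) g'(1)] by blast
    have "intrinsic_dist M d x z \<le> path_length d a2 b2 \<gamma>2"
      unfolding intrinsic_dist_def using g2 by (auto intro!: Inf_lower)
    also have "\<dots> \<le> ereal (p + h) + ereal (q + h)"
      using g2(2) g(2) g'(2) by (meson add_mono less_imp_le order_trans)
    also have "\<dots> = ereal w" by (simp add: h_def field_simps)
    finally show ?thesis using w by simp
  qed
qed

section \<open>Subdivision of a path into short steps\<close>

lemma continuous_map_dist_to:
  assumes "continuous_map X mtopology f" "x \<in> M"
  shows "continuous_map X euclideanreal (\<lambda>s. d x (f s))"
  using continuous_map_mdist[of X "metric (M,d)" "\<lambda>_. x" f] assms
  by (simp add: mdist_metric Metric_space_axioms)

text \<open>
  The way points are chosen greedily: each step covers distance exactly \<open>s\<close>, except for the last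
  one, which may be shorter. The full steps form part of a partition of the path, so there are at
  most \<open>l / s\<close> of them; exactness of the steps is what yields this count.
\<close>
lemma subdivide_path:
  assumes g: "connecting_path M d a b \<gamma> x y" and len: "path_length d a b \<gamma> \<le> ereal l" and s: "s > 0"
  obtains N p where "p 0 = x" "p N = y" "\<And>k. k \<le> N \<Longrightarrow> p k \<in> M"
    "\<And>k. k < N \<Longrightarrow> d (p k) (p (Suc k)) \<le> s"
    "(\<Sum>k<N. d (p k) (p (Suc k))) \<le> l" "real N \<le> l / s + 1"
proof -
  \<comment> \<open>\<open>P m\<close>: one can march along the path for \<open>m\<close> steps that each cover distance exactly \<open>s\<close>.\<close>
  define P where "P m \<longleftrightarrow> (\<exists>t :: nat \<Rightarrow> real. t 0 = a \<and> t m \<le> b \<and>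
      (\<forall>i<m. t i < t (Suc i) \<and> d (\<gamma> (t i)) (\<gamma> (t (Suc i))) = s))" for m
  have ab: "a \<le> b" "\<gamma> a = x" "\<gamma> b = y"
    and cg: "continuous_map (top_of_set {a..b}) mtopology \<gamma>"
    using g by (auto simp: connecting_path_def)
  have inM: "\<gamma> u \<in> M" if "u \<in> {a..b}" for u
    using connecting_path_in_space[OF g that] .
  have ext: "(\<forall>k\<le>Suc m. u k \<in> {a..b}) \<and> (\<Sum>k<Suc m. d (\<gamma> (u k)) (\<gamma> (u (Suc k)))) \<le> l"
    if t: "t 0 = a" "t m \<le> b" "\<forall>i<m. t i < t (Suc i)" and u: "u = t(Suc m := b)"
    for m and t u :: "nat \<Rightarrow> real"
  proof -
    have mono: "u i \<le> u (Suc i)" if "i < Suc m" for i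
      using that t by (auto simp: u less_Suc_eq less_imp_le)
    have ends: "u 0 = a" "u (Suc m) = b" using t by (auto simp: u)
    have rng: "u k \<in> {a..b}" if "k \<le> Suc m" for k
      using monotone_partition_within[of "Suc m" u k, OF mono that] ends by simp
    have "ereal (\<Sum>k<Suc m. d (\<gamma> (u k)) (\<gamma> (u (Suc k)))) \<le> path_length d a b \<gamma>"
      using ends mono inM[OF rng] by (rule sum_le_path_length)
    then have "ereal (\<Sum>k<Suc m. d (\<gamma> (u k)) (\<gamma> (u (Suc k)))) \<le> ereal l"
      using len by (rule order_trans)
    then show ?thesis using rng by (simp del: sum.lessThan_Suc)
  qed
  have bound: "real m * s \<le> l" if "P m" for m
  proof -
    obtain t where t: "t 0 = a" "t m \<le> b" "\<forall>i<m. t i < t (Suc i) \<and> d (\<gamma> (t i)) (\<gamma> (t (Suc i))) = s"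
      using \<open>P m\<close>[unfolded P_def] by (elim exE conjE)
    define u where "u = t(Suc m := b)"
    have "d (\<gamma> (u k)) (\<gamma> (u (Suc k))) = s" if "k < m" for k
    proof -
      have "u k = t k" "u (Suc k) = t (Suc k)" using that by (simp_all add: u_def)
      then show ?thesis using t(3) that by (simp only:)
    qed
    then have "(\<Sum>k<m. d (\<gamma> (u k)) (\<gamma> (u (Suc k)))) = real m * s"
      by simp
    moreover have "(\<Sum>k<m. d (\<gamma> (u k)) (\<gamma> (u (Suc k)))) \<le> (\<Sum>k<Suc m. d (\<gamma> (u k)) (\<gamma> (u (Suc k))))"
      by simp
    moreover have "(\<Sum>k<Suc m. d (\<gamma> (u k)) (\<gamma> (u (Suc k)))) \<le> l"
      using ext[of t m u] t u_def by blast
    ultimately show ?thesis by linarith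
  qed
  have P0: "P 0" using ab by (auto simp: P_def intro!: exI[of _ "\<lambda>_. a"])
  have "m \<le> nat \<lceil>l / s\<rceil>" if "P m" for m
  proof -
    have "real m \<le> l / s" using bound[OF that] s by (simp add: field_simps)
    then show ?thesis by linarith
  qed
  then obtain m where m: "P m" "\<And>m'. P m' \<Longrightarrow> m' \<le> m"
    using GreatestI_nat[of P 0 "nat \<lceil>l / s\<rceil>"] Greatest_le_nat[of P _ "nat \<lceil>l / s\<rceil>"] P0 by blast
  obtain t where t: "t 0 = a" "t m \<le> b" "\<forall>i<m. t i < t (Suc i) \<and> d (\<gamma> (t i)) (\<gamma> (t (Suc i))) = s"
    using m(1)[unfolded P_def] by (elim exE conjE)
  define u where "u = t(Suc m := b)"
  have E: "\<And>k. k \<le> Suc m \<Longrightarrow> u k \<in> {a..b}" "(\<Sum>k<Suc m. d (\<gamma> (u k)) (\<gamma> (u (Suc k)))) \<le> l"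
    using ext[of t m u] t u_def by blast+
  have tm: "t m \<in> {a..b}" using E(1)[of m] by (simp add: u_def)
  \<comment> \<open>After the last possible full step the end of the path is within \<open>s\<close>; otherwise the
    intermediate value theorem would provide one more.\<close>
  have last: "d (\<gamma> (t m)) (\<gamma> b) \<le> s"
  proof (rule ccontr)
    assume nle: "\<not> d (\<gamma> (t m)) (\<gamma> b) \<le> s"
    have "continuous_map (top_of_set {t m..b}) mtopology \<gamma>"
      using continuous_map_from_subtopology_mono[OF cg] tm by auto
    then have "continuous_on {t m..b} (\<lambda>v. d (\<gamma> (t m)) (\<gamma> v))"
      using continuous_map_dist_to[OF _ inM[OF tm]] by fastforce
    moreover have "d (\<gamma> (t m)) (\<gamma> (t m)) \<le> s" using inM[OF tm] s by simp
    ultimately obtain v where v: "t m \<le> v" "v \<le> b" "d (\<gamma> (t m)) (\<gamma> v) = s"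
      using IVT'[of "\<lambda>v. d (\<gamma> (t m)) (\<gamma> v)" "t m" s b] nle t(2) by auto
    then have "t m \<noteq> v" using inM[OF tm] s by auto
    then have "P (Suc m)"
      unfolding P_def
    proof (intro exI[of _ "t(Suc m := v)"] conjI allI impI)
      fix i assume "i < Suc m"
      then consider "i < m" | "i = m" by linarith
      then show "(t(Suc m := v)) i < (t(Suc m := v)) (Suc i)"
        "d (\<gamma> ((t(Suc m := v)) i)) (\<gamma> ((t(Suc m := v)) (Suc i))) = s"
        by (cases; use t(3) v \<open>t m \<noteq> v\<close> in simp)+
    qed (use t(1) v in simp_all)
    then show False using m(2) by fastforce
  qed
  show thesis
  proof (rule that[of "\<lambda>k. \<gamma> (u k)" "Suc m"])
    show "real (Suc m) \<le> l / s + 1" using bound[OF m(1)] s by (simp add: field_simps)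
    show "d (\<gamma> (u k)) (\<gamma> (u (Suc k))) \<le> s" if "k < Suc m" for k
    proof (cases "k = m")
      case True
      then show ?thesis using last by (simp add: u_def)
    next
      case False
      then have "k < m" using that by simp
      then have "u k = t k" "u (Suc k) = t (Suc k)" by (simp_all add: u_def)
      then show ?thesis using t(3) \<open>k < m\<close> by simp
    qed
    show "\<gamma> (u 0) = x" "\<gamma> (u (Suc m)) = y" using ab t(1) by (simp_all add: u_def)
    show "\<gamma> (u k) \<in> M" if "k \<le> Suc m" for k using inM E(1) that by blast
  qed (fact E(2))
qed

end

section \<open>Graph distances in a neighbourhood graph\<close>

lemma neighbourhood_graph_simps:
  "verts (neighbourhood_graph d V r) = V"
  "arcs (neighbourhood_graph d V r) = {(x, y). x \<in> V \<and> y \<in> V \<and> d x y \<le> r}"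
  "tail (neighbourhood_graph d V r) = fst"
  "head (neighbourhood_graph d V r) = snd"
  by (simp_all add: neighbourhood_graph_def)

lemma graph_dist_le_chain_length:
  assumes V: "\<And>k. k \<le> N \<Longrightarrow> p k \<in> V" and r: "\<And>k. k < N \<Longrightarrow> d (p k) (p (Suc k)) \<le> r"
  shows "graph_dist d V r (p 0) (p N) \<le> ereal (\<Sum>k<N. d (p k) (p (Suc k)))"
proof -
  interpret G: wf_digraph "neighbourhood_graph d V r" by (rule wf_digraph_neighbourhood_graph)
  have "G.awalk (p 0) (map (\<lambda>k. (p k, p (Suc k))) [0..<N]) (p N)"
    using assms
  proof (induction N)
    case 0
    then show ?case by (simp add: G.awalk_Nil_iff neighbourhood_graph_simps)
  next
    case (Suc N)
    then have "G.awalk (p N) [(p N, p (Suc N))] (p (Suc N))"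
      by (auto simp: G.awalk_simps neighbourhood_graph_simps)
    then show ?case using Suc by (auto intro!: G.awalk_appendI)
  qed
  moreover have "G.awalk_cost (\<lambda>(u, v). d u v) (map (\<lambda>k. (p k, p (Suc k))) [0..<N])
      = (\<Sum>k<N. d (p k) (p (Suc k)))"
    by (simp add: G.awalk_cost_def o_def interv_sum_list_conv_sum_set_nat atLeast0LessThan)
  ultimately show ?thesis
    unfolding graph_dist_def by (metis G.min_cost_le_walk_cost)
qed

context Metric_space
begin

text \<open>
  If no edge is shorter than its intrinsic distance by more than the factor \<open>c\<close>, then neither is any
  walk, by the triangle inequality for the intrinsic distance along the walk.
\<close>
lemma le_graph_dist_if_edges_not_shortcuts:
  assumes VM: "V \<subseteq> M" and c: "c > 0"
    and edge: "\<And>u v. u \<in> V \<Longrightarrow> v \<in> V \<Longrightarrow> d u v \<le> r \<Longrightarrow> intrinsic_dist M d u v \<le> ereal (c * d u v)"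
    and l: "ereal l \<le> intrinsic_dist M d x y"
  shows "ereal (l / c) \<le> graph_dist d V r x y"
proof -
  interpret G: wf_digraph "neighbourhood_graph d V r" by (rule wf_digraph_neighbourhood_graph)
  let ?w = "\<lambda>(u, v). d u v"
  have walk: "intrinsic_dist M d u v \<le> ereal (c * G.awalk_cost ?w p)" if "G.awalk u p v" for u p v
    using that
  proof (induction p arbitrary: u)
    case Nil
    then show ?case using VM intrinsic_dist_refl_le
      by (auto simp: G.awalk_Nil_iff neighbourhood_graph_simps zero_ereal_def[symmetric])
  next
    case (Cons e p)
    then have e: "e = (u, snd e)" "u \<in> V" "snd e \<in> V" "d u (snd e) \<le> r" "G.awalk (snd e) p v"
      by (auto simp: G.awalk_Cons_iff neighbourhood_graph_simps)
    have "intrinsic_dist M d u v \<le> intrinsic_dist M d u (snd e) + intrinsic_dist M d (snd e) v"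
      by (rule intrinsic_dist_triangle)
    also have "\<dots> \<le> ereal (c * d u (snd e)) + ereal (c * G.awalk_cost ?w p)"
      using edge e Cons.IH by (intro add_mono) auto
    also have "\<dots> = ereal (c * G.awalk_cost ?w (e # p))"
      by (subst (2) e(1)) (simp add: algebra_simps)
    finally show ?case .
  qed
  show ?thesis
    unfolding graph_dist_def G.\<mu>_def
  proof (rule INF_greatest, clarify)
    fix p assume "G.awalk x p y"
    then have "ereal l \<le> ereal (c * G.awalk_cost ?w p)" using walk l order_trans by blast
    then show "ereal (l / c) \<le> ereal (G.awalk_cost ?w p)" using c by (simp add: field_simps)
  qed
qed

end

section \<open>Covering by sample points and compactness\<close>

lemma covering_radius_nearest:
  assumes "n \<ge> 1" "covering_radius M d q n \<le> ereal e" "x \<in> M"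
  shows "\<exists>i\<in>{1..n}. d x (q i) \<le> e"
proof -
  have "ereal (MIN i\<in>{1..n}. d x (q i)) \<le> covering_radius M d q n"
    unfolding covering_radius_def using assms(3) by (rule SUP_upper)
  then have "(MIN i\<in>{1..n}. d x (q i)) \<le> e"
    using assms(2) by (metis ereal_less_eq(3) order_trans)
  then show ?thesis using assms(1) by (subst (asm) Min_le_iff) auto
qed

context Metric_space
begin

lemma covering_radius_nonneg:
  assumes "n \<ge> 1" "M \<noteq> {}"
  shows "0 \<le> covering_radius M d q n"
proof -
  obtain x where "x \<in> M" using assms(2) by blast
  have "0 \<le> (MIN i\<in>{1..n}. d x (q i))" using assms(1) by (subst Min_ge_iff) auto
  then have "0 \<le> ereal (MIN i\<in>{1..n}. d x (q i))" by simp
  also have "\<dots> \<le> covering_radius M d q n"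
    unfolding covering_radius_def using \<open>x \<in> M\<close> by (rule SUP_upper)
  finally show ?thesis .
qed

text \<open>
  The space is the union of the finitely many closed balls of radius \<open>e\<close> around the sample points,
  and these balls are compact in a proper space.
\<close>
lemma compactin_of_covering_radius_finite:
  assumes "proper_metric_space M d" "n \<ge> 1" "covering_radius M d q n \<le> ereal e"
    "\<And>k. k \<ge> 1 \<Longrightarrow> q k \<in> M"
  shows "compactin mtopology M"
proof -
  have "M = \<Union>((\<lambda>i. mcball (q i) e) ` {1..n})"
    using covering_radius_nearest[OF assms(2,3)] assms(4) by (fastforce simp: commute)
  moreover have "compactin mtopology (\<Union>((\<lambda>i. mcball (q i) e) ` {1..n}))"
    using assms by (intro compactin_Union) (auto simp: proper_metric_space_def)
  ultimately show ?thesis by simp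
qed

text \<open>
  By continuity at \<open>(p, p)\<close>, every point \<open>p\<close> has a neighbourhood \<open>U\<close> with \<open>\<omega> < \<eta>\<close> on \<open>U \<times> U\<close>. Two
  points closer than a Lebesgue number of this cover lie in a common \<open>U\<close>.
\<close>
lemma uniformly_small_near_diagonal:
  fixes \<omega> :: "'a \<Rightarrow> 'a \<Rightarrow> ereal"
  assumes "compactin mtopology M"
    and cont: "continuous_map (prod_topology mtopology mtopology) euclidean (\<lambda>(p, p0). \<omega> p p0)"
    and diag: "\<And>p. p \<in> M \<Longrightarrow> \<omega> p p = 0" and "\<eta> > 0"
  obtains \<rho> where "\<rho> > 0" "\<And>p p0. p \<in> M \<Longrightarrow> p0 \<in> M \<Longrightarrow> d p p0 < \<rho> \<Longrightarrow> \<omega> p p0 < \<eta>"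
proof -
  let ?C = "{U. openin mtopology U \<and> (\<forall>p\<in>U. \<forall>p0\<in>U. \<omega> p p0 < \<eta>)}"
  let ?W = "{z \<in> M \<times> M. (case z of (p, p0) \<Rightarrow> \<omega> p p0) \<in> {..<\<eta>}}"
  have W: "openin (prod_topology mtopology mtopology) ?W"
    using openin_continuous_map_preimage[OF cont, of "{..<\<eta>}"] by simp
  have "\<exists>U\<in>?C. p \<in> U" if "p \<in> M" for p
  proof -
    have "(p, p) \<in> ?W" using that diag \<open>\<eta> > 0\<close> by auto
    then obtain U V where UV: "openin mtopology U" "openin mtopology V" "p \<in> U" "p \<in> V" "U \<times> V \<subseteq> ?W"
      using W unfolding openin_prod_topology_alt by meson
    then have "U \<inter> V \<in> ?C" by (auto intro: openin_Int)
    then show ?thesis using UV by blast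
  qed
  then have cover: "M \<subseteq> \<Union>?C" by blast
  have "\<exists>\<epsilon>>0. \<forall>x\<in>M. \<exists>U\<in>?C. mball x \<epsilon> \<subseteq> U"
    by (rule lebesgue_number[OF assms(1) cover]) simp
  then obtain \<rho> where \<rho>: "\<rho> > 0" "\<forall>x\<in>M. \<exists>U\<in>?C. mball x \<rho> \<subseteq> U"
    by (elim exE conjE)
  show thesis
  proof (rule that[OF \<rho>(1)])
    fix p p0 assume p: "p \<in> M" "p0 \<in> M" "d p p0 < \<rho>"
    then obtain U where "U \<in> ?C" "mball p \<rho> \<subseteq> U" using \<rho> by blast
    moreover have "p \<in> mball p \<rho>" "p0 \<in> mball p \<rho>" using p \<rho>(1) by auto
    ultimately show "\<omega> p p0 < \<eta>" by blast
  qed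
qed

section \<open>Convergence of the graph distance\<close>

text \<open>
  The way points of a subdivided path are replaced by nearest sample points. This costs \<open>2 * e\<close> per
  step, and there are at most \<open>2 * l / r + 1\<close> steps.
\<close>
lemma graph_dist_le_of_path:
  assumes g: "connecting_path M d a b \<gamma> (q i) (q j)" "path_length d a b \<gamma> \<le> ereal l"
    and cov: "covering_radius M d q n \<le> ereal e" and e: "0 \<le> e" "4 * e \<le> r" and r: "0 < r"
    and q: "\<And>k. k \<ge> 1 \<Longrightarrow> q k \<in> M" and ij: "i \<in> {1..n}" "j \<in> {1..n}"
  shows "graph_dist d (q ` {1..n}) r (q i) (q j) \<le> ereal (l + 2 * e * (2 * l / r + 1))"
proof -
  \<comment> \<open>Steps of size \<open>r / 2\<close> leave room for the displacement \<open>2 * e \<le> r / 2\<close> of the end points.\<close>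
  obtain N p where p: "p 0 = q i" "p N = q j" "\<And>k. k \<le> N \<Longrightarrow> p k \<in> M"
    "\<And>k. k < N \<Longrightarrow> d (p k) (p (Suc k)) \<le> r / 2"
    "(\<Sum>k<N. d (p k) (p (Suc k))) \<le> l" "real N \<le> l / (r / 2) + 1"
    by (rule subdivide_path[OF g, of "r / 2"]) (use r in auto)
  \<comment> \<open>Points equal to an end point stay put, so that the snapped chain still joins
    \<open>q i\<close> to \<open>q j\<close>.\<close>
  have "\<exists>y. y \<in> q ` {1..n} \<and> d (p k) y \<le> e \<and> (p k \<in> {q i, q j} \<longrightarrow> y = p k)" if "k \<le> N" for k
  proof (cases "p k \<in> {q i, q j}")
    case True
    then show ?thesis using ij e(1) p(3)[OF that] by (intro exI[of _ "p k"]) auto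
  next
    case False
    then show ?thesis using covering_radius_nearest[OF _ cov p(3)[OF that]] ij by auto
  qed
  then obtain y where y: "\<And>k. k \<le> N \<Longrightarrow> y k \<in> q ` {1..n}" "\<And>k. k \<le> N \<Longrightarrow> d (p k) (y k) \<le> e"
    "\<And>k. k \<le> N \<Longrightarrow> p k \<in> {q i, q j} \<Longrightarrow> y k = p k"
    by metis
  have yM: "y k \<in> M" if "k \<le> N" for k using y(1)[OF that] q by auto
  have step: "d (y k) (y (Suc k)) \<le> d (p k) (p (Suc k)) + 2 * e" if "k < N" for k
    using triangle[of "y k" "p k" "y (Suc k)"] triangle[of "p k" "p (Suc k)" "y (Suc k)"]
      that y(2)[of k] y(2)[of "Suc k"] p(3)[of k] p(3)[of "Suc k"] yM[of k] yM[of "Suc k"]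
      commute[of "y k" "p k"] by auto
  have "graph_dist d (q ` {1..n}) r (y 0) (y N) \<le> ereal (\<Sum>k<N. d (y k) (y (Suc k)))"
  proof (rule graph_dist_le_chain_length)
    show "d (y k) (y (Suc k)) \<le> r" if "k < N" for k
      using step[OF that] p(4)[OF that] e by linarith
  qed (use y in auto)
  moreover have "y 0 = q i" "y N = q j" using y(3)[of 0] y(3)[of N] p by auto
  moreover have "(\<Sum>k<N. d (y k) (y (Suc k))) \<le> l + 2 * e * (2 * l / r + 1)"
  proof -
    have "(\<Sum>k<N. d (y k) (y (Suc k))) \<le> (\<Sum>k<N. d (p k) (p (Suc k)) + 2 * e)"
      using step by (intro sum_mono) auto
    also have "\<dots> \<le> l + 2 * e * real N" using p(5) by (simp add: sum.distrib mult.commute)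
    also have "\<dots> \<le> l + 2 * e * (2 * l / r + 1)"
      using p(6) e(1) by (intro add_left_mono mult_left_mono) (auto simp: mult.commute)
    finally show ?thesis .
  qed
  ultimately show ?thesis by (simp add: order_trans[OF _ ereal_less_eq(3)[THEN iffD2]])
qed

text \<open>
  Given \<open>c < L\<close> or \<open>c > L\<close>, the lower bound with a small fixed \<open>\<eta>\<close>, or the upper bound with a fixed
  path of length below \<open>c\<close>, puts the graph distance on the same side of \<open>c\<close> for all large \<open>n\<close>, where
  \<open>L\<close> is the intrinsic distance. One \<open>n\<close> with finite covering radius suffices for compactness.
\<close>
theorem graph_dist_tendsto_intrinsic_dist:
  fixes \<omega> :: "'a \<Rightarrow> 'a \<Rightarrow> ereal"
  assumes proper: "proper_metric_space M d"
    and q: "\<And>k. k \<ge> 1 \<Longrightarrow> q k \<in> M"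
    and cov: "(\<lambda>n. covering_radius M d q n) \<longlonglongrightarrow> 0"
    and distortion: "\<And>x y. x \<in> M \<Longrightarrow> y \<in> M \<Longrightarrow>
      intrinsic_dist M d x y = ereal (d x y) * (1 + \<omega> x y)"
    and cont: "continuous_map (prod_topology mtopology mtopology) euclidean (\<lambda>(x, y). \<omega> x y)"
    and diag: "\<And>x. x \<in> M \<Longrightarrow> \<omega> x x = 0"
    and ij: "i \<ge> 1" "j \<ge> 1"
    and fin: "intrinsic_dist M d (q i) (q j) < \<infinity>"
    and r: "\<And>n. r n > 0" "r \<longlonglongrightarrow> 0"
    and cov_r: "(\<lambda>n. covering_radius M d q n / ereal (r n)) \<longlonglongrightarrow> 0"
  shows "(\<lambda>n. graph_dist d (q ` {1..n}) (r n) (q i) (q j)) \<longlonglongrightarrow> intrinsic_dist M d (q i) (q j)"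
proof -
  define e where "e n = real_of_ereal (covering_radius M d q n)" for n
  have ne: "M \<noteq> {}" using q[of 1] by auto
  have "\<forall>\<^sub>F n in sequentially. covering_radius M d q n < 1"
    using order_tendstoD(2)[OF cov, of 1] by simp
  then have ev_e: "\<forall>\<^sub>F n in sequentially. covering_radius M d q n = ereal (e n) \<and> 0 \<le> e n"
    using eventually_ge_at_top[of 1]
  proof eventually_elim
    case (elim n)
    then show ?case using covering_radius_nonneg[of n q] ne
      by (cases "covering_radius M d q n") (auto simp: e_def)
  qed
  have e0: "e \<longlonglongrightarrow> 0"
    unfolding e_def using cov by (intro lim_real_of_ereal) (simp add: zero_ereal_def)
  \<comment> \<open>Division by \<open>ereal\<close> and by \<open>real\<close> agree only where the covering radius is finite.\<close>
  have er0: "(\<lambda>n. e n / r n) \<longlonglongrightarrow> 0"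
  proof (rule Lim_transform_eventually)
    show "(\<lambda>n. real_of_ereal (covering_radius M d q n / ereal (r n))) \<longlonglongrightarrow> 0"
      using cov_r by (intro lim_real_of_ereal) (simp add: zero_ereal_def)
    show "\<forall>\<^sub>F n in sequentially. real_of_ereal (covering_radius M d q n / ereal (r n)) = e n / r n"
      using ev_e by eventually_elim (use r(1) in \<open>simp add: less_imp_neq[symmetric]\<close>)
  qed
  obtain l where l: "intrinsic_dist M d (q i) (q j) = ereal l" "0 \<le> l"
    using fin intrinsic_dist_nonneg[of "q i" "q j"]
    by (cases "intrinsic_dist M d (q i) (q j)") auto
  obtain n0 where "n0 \<ge> 1" "covering_radius M d q n0 \<le> ereal (e n0)"
    using eventually_happens'[OF _ eventually_conj[OF eventually_ge_at_top[of "1::nat"] ev_e]] by auto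
  then have compact: "compactin mtopology M"
    using compactin_of_covering_radius_finite[OF proper] q by blast
  show ?thesis
    unfolding l(1)
  proof (rule order_tendstoI)
    fix c assume "c < ereal l"
    then obtain c' where c': "c < ereal c'" "c' < l"
      using ereal_dense2 by (metis less_ereal.simps(1))
    \<comment> \<open>Chosen so that \<open>l / (1 + \<eta>)\<close> still exceeds \<open>c'\<close>; the summand 1 covers \<open>l = 0\<close>.\<close>
    define \<eta> where "\<eta> = (l - c') / (2 * (l + 1))"
    have \<eta>: "\<eta> > 0" using c' l by (simp add: \<eta>_def)
    have "c' * \<eta> \<le> l * \<eta>" using c' \<eta> by simp
    also have "\<dots> < l - c'"
      using mult_strict_left_mono[of "l / (2 * (l + 1))" 1 "l - c'"] c'(2) l(2)
      by (simp add: \<eta>_def mult.commute)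
    finally have c'l: "c' < l / (1 + \<eta>)" using \<eta> by (simp add: field_simps)
    obtain \<rho> where \<rho>: "\<rho> > 0" "\<And>x y. x \<in> M \<Longrightarrow> y \<in> M \<Longrightarrow> d x y < \<rho> \<Longrightarrow> \<omega> x y < ereal \<eta>"
      using uniformly_small_near_diagonal[OF compact cont diag, of "ereal \<eta>"] \<eta> by auto
    have "\<forall>\<^sub>F n in sequentially. r n < \<rho>" using order_tendstoD(2)[OF r(2) \<rho>(1)] .
    then show "\<forall>\<^sub>F n in sequentially. c < graph_dist d (q ` {1..n}) (r n) (q i) (q j)"
    proof eventually_elim
      case (elim n)
      have "ereal (l / (1 + \<eta>)) \<le> graph_dist d (q ` {1..n}) (r n) (q i) (q j)"
      proof (rule le_graph_dist_if_edges_not_shortcuts)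
        show "q ` {1..n} \<subseteq> M" using q by auto
        fix u v assume uv: "u \<in> q ` {1..n}" "v \<in> q ` {1..n}" "d u v \<le> r n"
        then have uvM: "u \<in> M" "v \<in> M" using q by auto
        then have "intrinsic_dist M d u v = ereal (d u v) * (1 + \<omega> u v)" by (rule distortion)
        also have "\<dots> \<le> ereal (d u v) * (1 + ereal \<eta>)"
          using \<rho>(2)[OF uvM] uv(3) elim by (intro ereal_mult_left_mono add_left_mono) auto
        also have "\<dots> = ereal ((1 + \<eta>) * d u v)" by (simp add: one_ereal_def mult.commute)
        finally show "intrinsic_dist M d u v \<le> ereal ((1 + \<eta>) * d u v)" .
      qed (use \<eta> l in auto)
      moreover have "c < ereal (l / (1 + \<eta>))" using c' c'l by (meson less_ereal.simps(1) order.strict_trans)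
      ultimately show ?case by (rule less_le_trans[rotated])
    qed
  next
    fix c assume "ereal l < c"
    then obtain l' where l': "l < l'" "ereal l' < c"
      using ereal_dense2 by (metis less_ereal.simps(1))
    have "Inf {path_length d a b \<gamma> | a b \<gamma>. connecting_path M d a b \<gamma> (q i) (q j)} < ereal l'"
      using l l' unfolding intrinsic_dist_def by simp
    then obtain a b \<gamma> where \<gamma>: "connecting_path M d a b \<gamma> (q i) (q j)" "path_length d a b \<gamma> < ereal l'"
      unfolding Inf_less_iff by blast
    have "(\<lambda>n. ereal (l' + 4 * l' * (e n / r n) + 2 * e n)) \<longlonglongrightarrow> ereal (l' + 4 * l' * 0 + 2 * 0)"
      by (intro tendsto_intros er0 e0)
    then have "\<forall>\<^sub>F n in sequentially. ereal (l' + 4 * l' * (e n / r n) + 2 * e n) < c"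
      using l' by (intro order_tendstoD(2)) auto
    moreover have "\<forall>\<^sub>F n in sequentially. e n / r n < 1 / 4"
      using order_tendstoD(2)[OF er0, of "1 / 4"] by simp
    ultimately show "\<forall>\<^sub>F n in sequentially. graph_dist d (q ` {1..n}) (r n) (q i) (q j) < c"
      using ev_e eventually_ge_at_top[of "max i j"]
    proof eventually_elim
      case (elim n)
      have "graph_dist d (q ` {1..n}) (r n) (q i) (q j)
          \<le> ereal (l' + 2 * e n * (2 * l' / r n + 1))"
        by (rule graph_dist_le_of_path[OF \<gamma>(1)])
           (use elim r(1)[of n] \<gamma>(2) q ij in \<open>auto simp: field_simps\<close>)
      also have "\<dots> = ereal (l' + 4 * l' * (e n / r n) + 2 * e n)"
        by (simp add: algebra_simps)
      also have "\<dots> < c" using elim by simp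
      finally show ?case .
    qed
  qed
qed

end

theorem proposition2p10:
  fixes \<nu> :: "(real ^ 'd::finite) measure"
    and Q :: "(real ^ 'd \<Rightarrow> real) set"
    and \<delta> :: "(real ^ 'd \<Rightarrow> real) \<Rightarrow> (real ^ 'd \<Rightarrow> real) \<Rightarrow> real"
    and q :: "nat \<Rightarrow> (real ^ 'd \<Rightarrow> real)"
    and \<omega> :: "(real ^ 'd \<Rightarrow> real) \<Rightarrow> (real ^ 'd \<Rightarrow> real) \<Rightarrow> ereal"
    and r :: "nat \<Rightarrow> real"
    and i j :: nat
  assumes "space \<nu> = UNIV"
    and "\<forall>p\<in>Q. prob_density \<nu> p"
    and "proper_metric_space Q \<delta>"
    and "\<forall>k\<ge>1. q k \<in> Q"
    and "(\<lambda>n. covering_radius Q \<delta> q n) \<longlonglongrightarrow> 0"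
    and "\<forall>p\<in>Q. \<forall>p0\<in>Q. intrinsic_dist Q \<delta> p p0 = ereal (\<delta> p p0) * (1 + \<omega> p p0)"
    and "continuous_map
           (prod_topology (Metric_space.mtopology Q \<delta>) (Metric_space.mtopology Q \<delta>))
           euclidean (\<lambda>(p, p0). \<omega> p p0)"
    and "\<forall>p\<in>Q. \<omega> p p = 0"
    and "i \<ge> 1" and "j \<ge> 1"
    and "intrinsic_dist Q \<delta> (q i) (q j) < \<infinity>"
    and "\<forall>n. r n > 0"
    and "r \<longlonglongrightarrow> 0"
    and "(\<lambda>n. covering_radius Q \<delta> q n / ereal (r n)) \<longlonglongrightarrow> 0"
  shows "(\<lambda>n. graph_dist \<delta> (q ` {1..n}) (r n) (q i) (q j))
           \<longlonglongrightarrow> intrinsic_dist Q \<delta> (q i) (q j)"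
proof -
  interpret Metric_space Q \<delta>
    using assms(3) by (simp add: proper_metric_space_def)
  show ?thesis
    by (rule graph_dist_tendsto_intrinsic_dist
          [OF assms(3) _ assms(5) _ assms(7) _ assms(9,10,11) _ assms(13,14)])
       (use assms(4,6,8,12) in blast)+
qed

end
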